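(* Let $r,m,n\ge 1$ be integers, and let $p_1,\dots,p_r$ and $g_1,\dots,g_m$ be SOS-convex polynomials on $\mathbb{R}^n$ such that $\mathcal F:=\{x\in\mathbb{R}^n : g_i(x)\le 0,\ i=1,\dots,m\}\neq\emptyset$. Let $d$ be the smallest even number such that $d\ge\max\{\max_j\deg p_j,\ \max_i\deg g_i\}$. Consider $$(P)\quad \inf_{x\in\mathcal F}\ \max_{1\le j\le r}p_j(x)$$ and $$(D)\quad \sup\Big\{\mu : \sum_{j=1}^r\delta_jp_j+\sum_{i=1}^m\lambda_ig_i-\mu\in\Sigma^2_d,\ \delta\in\Delta,\ \lambda\in\mathbb{R}^m_+,\ \mu\in\mathbb{R}\Big\}.$$ Let $x^*\in\mathcal F$ be an optimal solution of $(P)$ and assume that the normal cone condition for $\mathcal F$ holds at $x^*$. Then $\min(P)=\max(D)$; that is, the optimal values of $(P)$ and $(D)$ are equal and both are attained.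
   Context: $\mathbb{R}^k_+$ denotes the set of vectors in $\mathbb{R}^k$ with nonnegative coordinates, and $\Delta:=\{\delta\in\mathbb{R}^r_+ : \sum_{j=1}^r\delta_j=1\}$. A real polynomial $f$ on $\mathbb{R}^n$ is a sum of squares if $f=\sum_{l=1}^s f_l^2$ for some real polynomials $f_1,\dots,f_s$; $\Sigma^2_d$ is the set of sum of squares real polynomials on $\mathbb{R}^n$ of degree at most $d$. A real polynomial $f$ on $\mathbb{R}^n$ is SOS-convex if its Hessian is an SOS-matrix polynomial, i.e. $\nabla^2 f(x)=H(x)H(x)^T$ for some $s\in\mathbb{N}$ and some matrix polynomial $H\in\mathbb{R}[x]^{n\times s}$. For a convex set $C\subset\mathbb{R}^n$ and $x\in C$, the normal cone is $N_C(x):=\{v\in\mathbb{R}^n : v^T(y-x)\le 0\ \forall y\in C\}$. The normal cone condition holds for $\mathcal F$ at $x\in\mathcal F$ if $N_{\mathcal F}(x)=\{\sum_{i=1}^m\lambda_i\nabla g_i(x) : \lambda\in\mathbb{R}^m_+,\ \sum_{i=1}^m\lambda_ig_i(x)=0\}$. *)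

theory Defs
  imports "HOL-Analysis.Analysis"
begin

text \<open>
  Real polynomials on \<open>\<real>\<^sup>n\<close> are represented by polynomial functions
  (\<^const>\<open>real_polynomial_function\<close> on \<open>real ^ 'n\<close>); since the reals are an infinite field,
  polynomials and polynomial functions correspond one-to-one.
\<close>

definition monom_fun :: "('n::finite \<Rightarrow> nat) \<Rightarrow> real ^ 'n \<Rightarrow> real" where
  "monom_fun \<alpha> x = (\<Prod>i\<in>UNIV. (x $ i) ^ \<alpha> i)"

text \<open>
  The index set \<open>{\<alpha>. sum \<alpha> UNIV \<le> k}\<close> is finite because \<open>'n\<close> is. The zero polynomial gets
  degree 0, and the value is meaningful for polynomial functions only.
\<close>

definition total_degree :: "(real ^ 'n \<Rightarrow> real) \<Rightarrow> nat" where
  "total_degree f =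
     (LEAST k. \<exists>c. \<forall>x. f x = (\<Sum>\<alpha> | sum \<alpha> UNIV \<le> k. c \<alpha> * monom_fun \<alpha> x))"

definition sum_of_squares :: "(real ^ 'n \<Rightarrow> real) \<Rightarrow> bool" where
  "sum_of_squares f \<longleftrightarrow>
     (\<exists>(s::nat) q. (\<forall>l<s. real_polynomial_function (q l)) \<and> (\<forall>x. f x = (\<Sum>l<s. (q l x)\<^sup>2)))"

definition SOS_le :: "nat \<Rightarrow> (real ^ 'n \<Rightarrow> real) set" where
  "SOS_le d = {f. real_polynomial_function f \<and> sum_of_squares f \<and> total_degree f \<le> d}"

definition partial_deriv :: "'n \<Rightarrow> (real ^ 'n \<Rightarrow> real) \<Rightarrow> real ^ 'n \<Rightarrow> real" where
  "partial_deriv i f x = frechet_derivative f (at x) (axis i 1)"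

definition grad :: "(real ^ 'n \<Rightarrow> real) \<Rightarrow> real ^ 'n \<Rightarrow> real ^ 'n" where
  "grad f x = (\<chi> i. partial_deriv i f x)"

definition hessian :: "(real ^ 'n \<Rightarrow> real) \<Rightarrow> real ^ 'n \<Rightarrow> real ^ 'n ^ 'n" where
  "hessian f x = (\<chi> i j. partial_deriv i (partial_deriv j f) x)"

text \<open>
  The number \<open>s\<close> of columns of \<open>H\<close> is existentially quantified, so it cannot be a type;
  \<open>H i l\<close> with \<open>l < s\<close> is the entry in row \<open>i\<close> and column \<open>l\<close> of an \<open>n \<times> s\<close> matrix polynomial.
\<close>

definition SOS_matrix_polynomial :: "(real ^ 'n \<Rightarrow> real ^ 'n ^ 'n) \<Rightarrow> bool" where
  "SOS_matrix_polynomial M \<longleftrightarrow>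
     (\<exists>(s::nat) (H :: 'n \<Rightarrow> nat \<Rightarrow> real ^ 'n \<Rightarrow> real).
        (\<forall>i. \<forall>l<s. real_polynomial_function (H i l)) \<and>
        (\<forall>x i j. M x $ i $ j = (\<Sum>l<s. H i l x * H j l x)))"

definition SOS_convex :: "(real ^ 'n \<Rightarrow> real) \<Rightarrow> bool" where
  "SOS_convex f \<longleftrightarrow> real_polynomial_function f \<and> SOS_matrix_polynomial (hessian f)"

definition nonneg_orthant :: "(real ^ 'k) set" where
  "nonneg_orthant = {v. \<forall>i. 0 \<le> v $ i}"

definition unit_simplex :: "(real ^ 'r) set" where
  "unit_simplex = {\<delta> \<in> nonneg_orthant. (\<Sum>j\<in>UNIV. \<delta> $ j) = 1}"

definition normal_cone :: "(real ^ 'n) set \<Rightarrow> real ^ 'n \<Rightarrow> (real ^ 'n) set" where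
  "normal_cone C x = {v. \<forall>y\<in>C. v \<bullet> (y - x) \<le> 0}"

definition feasible_set :: "('m \<Rightarrow> real ^ 'n \<Rightarrow> real) \<Rightarrow> (real ^ 'n) set" where
  "feasible_set g = {x. \<forall>i. g i x \<le> 0}"

definition normal_cone_condition ::
    "('m::finite \<Rightarrow> real ^ 'n \<Rightarrow> real) \<Rightarrow> real ^ 'n \<Rightarrow> bool" where
  "normal_cone_condition g x \<longleftrightarrow>
     normal_cone (feasible_set g) x =
       {\<Sum>i\<in>UNIV. (\<nu> $ i) *\<^sub>R grad (g i) x | \<nu> :: real ^ 'm.
          \<nu> \<in> nonneg_orthant \<and> (\<Sum>i\<in>UNIV. \<nu> $ i * g i x) = 0}"

definition primal_objective :: "('r::finite \<Rightarrow> real ^ 'n \<Rightarrow> real) \<Rightarrow> real ^ 'n \<Rightarrow> real" where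
  "primal_objective p x = Max (range (\<lambda>j. p j x))"

text \<open>
  Optimal values are taken in the extended reals, so that they are the true infimum and supremum
  also for unbounded or infeasible problems.
\<close>

definition primal_value ::
    "('r::finite \<Rightarrow> real ^ 'n \<Rightarrow> real) \<Rightarrow> ('m \<Rightarrow> real ^ 'n \<Rightarrow> real) \<Rightarrow> ereal" where
  "primal_value p g = (INF x\<in>feasible_set g. ereal (primal_objective p x))"

definition dual_feasible ::
    "nat \<Rightarrow> ('r::finite \<Rightarrow> real ^ 'n \<Rightarrow> real) \<Rightarrow> ('m::finite \<Rightarrow> real ^ 'n \<Rightarrow> real) \<Rightarrow>
     ((real ^ 'r) \<times> (real ^ 'm) \<times> real) set" where
  "dual_feasible d p g =
     {(\<delta>, \<nu>, \<mu>). \<delta> \<in> unit_simplex \<and> \<nu> \<in> nonneg_orthant \<and>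
        (\<lambda>x. (\<Sum>j\<in>UNIV. \<delta> $ j * p j x) + (\<Sum>i\<in>UNIV. \<nu> $ i * g i x) - \<mu>) \<in> SOS_le d}"

definition dual_value ::
    "nat \<Rightarrow> ('r::finite \<Rightarrow> real ^ 'n \<Rightarrow> real) \<Rightarrow> ('m::finite \<Rightarrow> real ^ 'n \<Rightarrow> real) \<Rightarrow> ereal" where
  "dual_value d p g = (SUP (\<delta>, \<nu>, \<mu>)\<in>dual_feasible d p g. ereal \<mu>)"

end

theory Submission
  imports Defs
begin

text \<open>
  The Taylor remainder \<open>f x - f a - grad f a \<bullet> (x - a)\<close> of an SOS-convex polynomial is the
  integral of \<open>1 - t\<close> times the second derivative of \<open>f\<close> along the segment from \<open>a\<close> to \<open>x\<close>.
  That second derivative is a sum of squares of polynomials in \<open>t\<close> whose coefficients are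
  polynomials in \<open>x\<close>; integrating turns each square into a positive semidefinite quadratic form in
  these coefficients, so the remainder is a sum of squares, and \<open>f\<close> is convex.
  Convex separation yields weights \<open>\<delta>\<close> in the simplex such that \<open>xstar\<close> minimizes
  \<open>\<Sum>\<^sub>j \<delta>\<^sub>j p\<^sub>j\<close> over the feasible set; minus the gradient of this sum lies in the normal cone, which
  gives multipliers \<open>\<nu>\<close>. In the Lagrangian minus the optimal value, the first-order terms at
  \<open>xstar\<close> cancel, so it is a nonnegative combination of Taylor remainders.
\<close>

section \<open>Positive semidefinite forms and second-order remainders\<close>

text \<open>Complete the square in the last variable. What is left is the form of the Schur
  complement of the corner entry, which is again positive semidefinite and has one variable fewer.
  The rows of \<open>A\<close> form a Cholesky-type factor.\<close>

lemma psd_form_eq_sum_squares: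
  fixes B :: "nat \<Rightarrow> nat \<Rightarrow> real"
  assumes "\<And>i j. B i j = B j i"
    and "\<And>c. 0 \<le> (\<Sum>i<N. \<Sum>j<N. B i j * c i * c j)"
  shows "\<exists>A. \<forall>c. (\<Sum>i<N. \<Sum>j<N. B i j * c i * c j) = (\<Sum>l<N. (\<Sum>k<N. A l k * c k)\<^sup>2)"
  using assms
proof (induction N arbitrary: B)
  case 0
  then show ?case by simp
next
  case (Suc N)
  note sym = Suc.prems(1) and psd = Suc.prems(2)
  define b where "b = B N N"
  have split: "(\<Sum>i<Suc N. \<Sum>j<Suc N. B i j * c i * c j) =
      (\<Sum>i<N. \<Sum>j<N. B i j * c i * c j) + 2 * c N * (\<Sum>i<N. B i N * c i) + b * (c N)\<^sup>2" for c
    by (simp add: sum.distrib b_def sum_distrib_left algebra_simps power2_eq_square sym)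
  \<comment> \<open>The value of the form at a unit vector is a diagonal entry.\<close>
  have single: "(\<Sum>i<N. \<Sum>j<N. B i j * (if i = m then 1 else 0) * (if j = m then 1 else 0)) = B m m"
    if "m < N" for m
  proof -
    have "(\<Sum>i<N. \<Sum>j<N. B i j * (if i = m then 1 else 0) * (if j = m then 1 else 0)) =
        (\<Sum>i<N. if i = m then B m m else 0)"
      using that by (intro sum.cong) (auto simp: if_distrib[of "\<lambda>x. _ * x"] cong: if_cong)
    then show ?thesis using that by simp
  qed
  have b0: "0 \<le> b"
  proof -
    have "0 \<le> (\<Sum>i<N. \<Sum>j<N. B i j * (0::real) * 0) + 2 * 1 * (\<Sum>i<N. B i N * 0) + b * 1\<^sup>2"
      using psd[of "\<lambda>i. if i = N then 1 else 0"] unfolding split by simp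
    then show ?thesis by simp
  qed
  have col: "B m N = 0" if "b = 0" "m < N" for m
  proof (rule ccontr)
    assume ne: "B m N \<noteq> 0"
    \<comment> \<open>A zero diagonal entry forces its column to vanish. With 1 in position
      \<open>m\<close> and \<open>y\<close> in position \<open>N\<close>, the form is affine in
      \<open>y\<close> with slope \<open>2 * B m N\<close>; this \<open>y\<close> makes it
      -1.\<close>
    define y where "y = - (B m m + 1) / (2 * B m N)"
    define c where "c = (\<lambda>i. if i = N then y else if i = m then 1 else (0::real))"
    have "0 \<le> (\<Sum>i<N. \<Sum>j<N. B i j * c i * c j) + 2 * c N * (\<Sum>i<N. B i N * c i)"
      using psd[of c] unfolding split by (simp add: that)
    also have "(\<Sum>i<N. \<Sum>j<N. B i j * c i * c j) =
        (\<Sum>i<N. \<Sum>j<N. B i j * (if i = m then 1 else 0) * (if j = m then 1 else 0))"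
      by (intro sum.cong) (auto simp: c_def)
    also have "\<dots> = B m m" using single that by simp
    also have "(\<Sum>i<N. B i N * c i) = (\<Sum>i<N. if i = m then B m N else 0)"
      by (intro sum.cong) (auto simp: c_def)
    also have "\<dots> = B m N" using that by simp
    finally have "0 \<le> B m m + 2 * y * B m N" by (simp add: c_def)
    also have "\<dots> = -1" using ne by (simp add: y_def field_simps)
    finally show False by simp
  qed
  \<comment> \<open>Schur complement; if \<open>b = 0\<close> the column vanishes and division by zero does no harm\<close>
  define B' where "B' = (\<lambda>i j. B i j - B i N * B j N / b)"
  have complete: "(\<Sum>i<Suc N. \<Sum>j<Suc N. B i j * c i * c j) =
      (\<Sum>i<N. \<Sum>j<N. B' i j * c i * c j) + (\<Sum>k<Suc N. (B k N / sqrt b) * c k)\<^sup>2" for c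
  proof -
    have 1: "(\<Sum>i<N. \<Sum>j<N. B' i j * c i * c j) =
        (\<Sum>i<N. \<Sum>j<N. B i j * c i * c j) - (\<Sum>i<N. B i N * c i)\<^sup>2 / b"
      by (simp add: B'_def power2_eq_square sum_product left_diff_distrib right_diff_distrib sum_subtractf
          sum_divide_distrib mult_ac)
    have "(\<Sum>k<Suc N. (B k N / sqrt b) * c k) = (\<Sum>k<Suc N. B k N * c k) / sqrt b"
      by (simp add: sum_divide_distrib add_divide_distrib)
    also have "\<dots>\<^sup>2 = (\<Sum>k<Suc N. B k N * c k)\<^sup>2 / b"
      using b0 by (simp add: power_divide)
    finally have 2: "(\<Sum>k<Suc N. (B k N / sqrt b) * c k)\<^sup>2 =
        ((\<Sum>k<N. B k N * c k) + b * c N)\<^sup>2 / b" by (simp add: b_def)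
    show ?thesis
    proof (cases "b = 0")
      case True
      then show ?thesis unfolding 1 2 split by (simp add: col)
    next
      case False
      then show ?thesis unfolding 1 2 split by (simp add: field_simps power2_eq_square)
    qed
  qed
  have "0 \<le> (\<Sum>i<N. \<Sum>j<N. B' i j * c i * c j)" for c
  proof -
    \<comment> \<open>The last coordinate is free, and this choice kills the squared linear form, so
      the Schur complement form equals the full form at \<open>c'\<close>. For \<open>b = 0\<close>
      the coefficients of the linear form are zero by the division convention.\<close>
    define c' where "c' = c(N := - (\<Sum>i<N. B i N * c i) / b)"
    have sq: "(\<Sum>k<Suc N. (B k N / sqrt b) * c' k) = 0"
    proof (cases "b = 0")
      case False
      have "(\<Sum>k<Suc N. (B k N / sqrt b) * c' k) = (\<Sum>k<Suc N. B k N * c' k) / sqrt b"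
        by (simp add: sum_divide_distrib add_divide_distrib)
      also have "(\<Sum>k<Suc N. B k N * c' k) = (\<Sum>k<N. B k N * c k) + b * c' N"
        by (simp add: b_def c'_def)
      also have "\<dots> = 0" using False by (simp add: c'_def)
      finally show ?thesis by simp
    qed (simp)
    show ?thesis using psd[of c'] unfolding complete sq by (simp add: c'_def)
  qed
  moreover have "B' i j = B' j i" for i j by (simp add: B'_def sym[of i j])
  ultimately obtain A where A:
    "\<forall>c. (\<Sum>i<N. \<Sum>j<N. B' i j * c i * c j) = (\<Sum>l<N. (\<Sum>k<N. A l k * c k)\<^sup>2)"
    using Suc.IH[of B'] by blast
  \<comment> \<open>Row \<open>N\<close> is the linear form just split off; the earlier rows come
    from the Schur complement and are padded with a zero last entry.\<close>
  define A' where "A' = (\<lambda>l k. if l = N then B k N / sqrt b else if k = N then 0 else A l k)"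
  have "(\<Sum>i<Suc N. \<Sum>j<Suc N. B i j * c i * c j) = (\<Sum>l<Suc N. (\<Sum>k<Suc N. A' l k * c k)\<^sup>2)" for c
    unfolding complete using A by (simp add: A'_def)
  then show ?case by blast
qed

section \<open>Univariate Taylor remainders as quadratic forms in coefficients\<close>

text \<open>Apply the mean value theorem twice: first to \<open>h\<close> on [0, 1], giving
  \<open>h' z\<close>, then to \<open>h'\<close> on [0, z].\<close>

lemma second_order_remainder_nonneg:
  fixes h h' h'' :: "real \<Rightarrow> real"
  assumes "\<And>t. (h has_real_derivative h' t) (at t)" "\<And>t. (h' has_real_derivative h'' t) (at t)"
    and "\<And>t. 0 \<le> h'' t"
  shows "0 \<le> h 1 - h 0 - h' 0"
proof -
  obtain z where z: "0 < z" "z < 1" "h 1 - h 0 = (1 - 0) * h' z"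
    using MVT2[of 0 1 h h'] assms(1) by auto
  obtain w where w: "h' z - h' 0 = (z - 0) * h'' w"
    using MVT2[of 0 z h' h''] z assms(2) by auto
  have "0 \<le> h' z - h' 0" using w z assms(3) by simp
  then show ?thesis using z by simp
qed

text \<open>The weight is the integral of \<open>(1 - t) * t ^ (i + j)\<close> over \<open>0 \<le> t \<le> 1\<close>.\<close>
definition taylor_weight :: "nat \<Rightarrow> nat \<Rightarrow> real" where
  "taylor_weight i j = 1 / ((real (i + j) + 1) * (real (i + j) + 2))"

text \<open>Expand the square into a double sum and integrate termwise twice from 0. Both
  \<open>w\<close> and \<open>w'\<close> vanish at 0, and \<open>w 1\<close> is the form with matrix
  \<open>taylor_weight\<close>.\<close>

lemma double_antiderivative_square:
  fixes c :: "nat \<Rightarrow> real" and N :: nat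
  defines "w \<equiv> \<lambda>t. \<Sum>i<N. \<Sum>j<N. taylor_weight i j * c i * c j * t ^ (i + j + 2)"
    and "w' \<equiv> \<lambda>t. \<Sum>i<N. \<Sum>j<N. 1 / (real (i + j) + 1) * c i * c j * t ^ (i + j + 1)"
  shows "(w has_real_derivative w' t) (at t)"
    and "(w' has_real_derivative (\<Sum>i<N. c i * t ^ i)\<^sup>2) (at t)"
proof -
  show "(w has_real_derivative w' t) (at t)"
    unfolding w_def w'_def
  proof (intro DERIV_sum)
    fix i j
    show "((\<lambda>t. taylor_weight i j * c i * c j * t ^ (i + j + 2)) has_real_derivative
        1 / (real (i + j) + 1) * c i * c j * t ^ (i + j + 1)) (at t)"
      by (rule derivative_eq_intros refl)+ (simp add: taylor_weight_def divide_simps; simp add: algebra_simps)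
  qed
  have "(w' has_real_derivative (\<Sum>i<N. \<Sum>j<N. c i * c j * t ^ (i + j))) (at t)"
    unfolding w'_def
  proof (intro DERIV_sum)
    fix i j
    show "((\<lambda>t. 1 / (real (i + j) + 1) * c i * c j * t ^ (i + j + 1)) has_real_derivative
        c i * c j * t ^ (i + j)) (at t)"
      by (rule derivative_eq_intros refl)+ (simp add: divide_simps; simp add: algebra_simps)
  qed
  then show "(w' has_real_derivative (\<Sum>i<N. c i * t ^ i)\<^sup>2) (at t)"
    by (simp add: power2_eq_square sum_product power_add mult_ac)
qed

text \<open>The form is the remainder at 1 of a function that vanishes at 0 together with its
  derivative and whose second derivative is a square.\<close>

lemma taylor_weight_psd: "0 \<le> (\<Sum>i<N. \<Sum>j<N. taylor_weight i j * c i * c j)"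
  using second_order_remainder_nonneg[OF double_antiderivative_square[where N = N and c = c]] by simp

text \<open>The order of quantifiers matters: one matrix \<open>A\<close> serves all coefficient
  vectors, so these may later vary polynomially with a point.\<close>

lemma taylor_weight_form_eq_sum_squares:
  "\<exists>A. \<forall>c. (\<Sum>i<N. \<Sum>j<N. taylor_weight i j * c i * c j) = (\<Sum>l<N. (\<Sum>k<N. A l k * c k)\<^sup>2)"
  by (rule psd_form_eq_sum_squares[OF _ taylor_weight_psd]) (simp add: taylor_weight_def add.commute)

text \<open>\<open>h\<close> and the explicit double antiderivative \<open>w\<close> have the same
  second derivative, so they differ by an affine function, which has zero remainder; the remainder
  of \<open>w\<close> is \<open>w 1\<close>.\<close>

lemma taylor_remainder_of_squares:
  fixes h h' :: "real \<Rightarrow> real" and c :: "nat \<Rightarrow> nat \<Rightarrow> real"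
  assumes "\<And>t. (h has_real_derivative h' t) (at t)"
    and "\<And>t. (h' has_real_derivative (\<Sum>l<s. (\<Sum>i<N. c l i * t ^ i)\<^sup>2)) (at t)"
  shows "h 1 - h 0 - h' 0 = (\<Sum>l<s. \<Sum>i<N. \<Sum>j<N. taylor_weight i j * c l i * c l j)"
proof -
  define w where "w = (\<lambda>t. \<Sum>l<s. \<Sum>i<N. \<Sum>j<N. taylor_weight i j * c l i * c l j * t ^ (i + j + 2))"
  define w' where "w' = (\<lambda>t. \<Sum>l<s. \<Sum>i<N. \<Sum>j<N. 1 / (real (i + j) + 1) * c l i * c l j * t ^ (i + j + 1))"
  have w: "(w has_real_derivative w' t) (at t)"
    "(w' has_real_derivative (\<Sum>l<s. (\<Sum>i<N. c l i * t ^ i)\<^sup>2)) (at t)" for t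
    unfolding w_def w'_def by (intro DERIV_sum double_antiderivative_square)+
  have "((\<lambda>t. h' t - w' t) has_real_derivative 0) (at t)" for t
    using DERIV_diff[OF assms(2) w(2)] by simp
  then have "h' t - w' t = h' 0 - w' 0" for t
    using DERIV_isconst_all by blast
  moreover have "w' 0 = 0" by (simp add: w'_def)
  ultimately have d1: "h' t = h' 0 + w' t" for t
    by (smt (verit))
  have "((\<lambda>t. h t - w t - t * h' 0) has_real_derivative 0) (at t)" for t
    using DERIV_diff[OF DERIV_diff[OF assms(1) w(1)] DERIV_cmult_right[OF DERIV_ident,
          where c = "h' 0"], of t]
    by (simp add: d1[of t])
  then have "h 1 - w 1 - 1 * h' 0 = h 0 - w 0 - 0 * h' 0"
    by (rule DERIV_isconst_all[rule_format])
  then show ?thesis by (simp add: w_def)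
qed

section \<open>Taylor remainders of SOS-convex polynomials\<close>

lemma real_polynomial_function_has_derivative_grad:
  fixes f :: "real ^ 'n \<Rightarrow> real"
  assumes "real_polynomial_function f"
  shows "(f has_derivative (\<lambda>v. grad f x \<bullet> v)) (at x)"
proof -
  have "f differentiable at x"
    using assms differentiable_at_polynomial_function real_polynomial_function_eq by blast
  then have d: "(f has_derivative frechet_derivative f (at x)) (at x)"
    by (simp add: frechet_derivative_works)
  interpret bounded_linear "frechet_derivative f (at x)"
    using d by (rule has_derivative_bounded_linear)
  have "frechet_derivative f (at x) = (\<lambda>v. grad f x \<bullet> v)"
  proof
    fix v
    have "frechet_derivative f (at x) v =
        frechet_derivative f (at x) (\<Sum>i\<in>UNIV. (v $ i) *\<^sub>R axis i 1)"
      using basis_expansion[of v] by (simp add: scalar_mult_eq_scaleR)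
    also have "\<dots> = grad f x \<bullet> v"
      by (simp add: sum scaleR inner_vec_def grad_def partial_deriv_def mult.commute)
    finally show "frechet_derivative f (at x) v = grad f x \<bullet> v" .
  qed
  then show ?thesis using d by simp
qed

lemma partial_deriv_eqI:
  assumes "(f has_derivative f') (at x)"
  shows "partial_deriv i f x = f' (axis i 1)"
  using frechet_derivative_at[OF assms] by (simp add: partial_deriv_def)

text \<open>Allows partial derivatives to be differentiated once more, as the Hessian along a line
  requires.\<close>

lemma real_polynomial_function_partial_deriv:
  fixes f :: "real ^ 'n \<Rightarrow> real"
  assumes "real_polynomial_function f"
  shows "real_polynomial_function (partial_deriv i f)"
  using assms
proof (induction f rule: real_polynomial_function.induct)
  case (linear f)
  have "partial_deriv i f x = f (axis i 1)" for x
    using linear by (intro partial_deriv_eqI bounded_linear_imp_has_derivative)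
  then have "partial_deriv i f = (\<lambda>x. f (axis i 1))" by blast
  then show ?case by auto
next
  case (const c)
  have "partial_deriv i (\<lambda>x. c) x = 0" for x :: "real ^ 'n"
    using partial_deriv_eqI[OF has_derivative_const] .
  then have "partial_deriv i (\<lambda>x :: real ^ 'n. c) = (\<lambda>x. 0)" by blast
  then show ?case by auto
next
  case (add f g)
  have "partial_deriv i (\<lambda>x. f x + g x) x = partial_deriv i f x + partial_deriv i g x" for x
    using partial_deriv_eqI[OF has_derivative_add[OF
          add.hyps(1,2)[THEN real_polynomial_function_has_derivative_grad]]]
    by (simp add: grad_def inner_axis)
  then have "partial_deriv i (\<lambda>x. f x + g x) = (\<lambda>x. partial_deriv i f x + partial_deriv i g x)"
    by blast
  then show ?case using add by auto
next
  case (mult f g)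
  have "partial_deriv i (\<lambda>x. f x * g x) x = f x * partial_deriv i g x + partial_deriv i f x * g x" for x
    using partial_deriv_eqI[OF has_derivative_mult[OF
          mult.hyps(1,2)[THEN real_polynomial_function_has_derivative_grad]]]
    by (simp add: grad_def inner_axis)
  then have "partial_deriv i (\<lambda>x. f x * g x) =
      (\<lambda>x. f x * partial_deriv i g x + partial_deriv i f x * g x)"
    by blast
  then show ?case using mult by auto
qed

lemma real_polynomial_function_has_derivative_line:
  fixes f :: "real ^ 'n \<Rightarrow> real"
  assumes "real_polynomial_function f"
  shows "((\<lambda>t. f (a + t *\<^sub>R v)) has_real_derivative grad f (a + t *\<^sub>R v) \<bullet> v) (at t)"
proof -
  have "((\<lambda>t. a + t *\<^sub>R v) has_derivative (\<lambda>s. s *\<^sub>R v)) (at t)"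
    by (auto intro!: derivative_eq_intros)
  from has_derivative_compose[OF this real_polynomial_function_has_derivative_grad[OF assms]]
  show ?thesis by (simp add: has_field_derivative_def mult_commute_abs)
qed

lemma real_polynomial_function_has_second_derivative_line:
  fixes f :: "real ^ 'n \<Rightarrow> real"
  assumes "real_polynomial_function f"
  shows "((\<lambda>t. grad f (a + t *\<^sub>R v) \<bullet> v) has_real_derivative
    (\<Sum>i\<in>UNIV. \<Sum>j\<in>UNIV. hessian f (a + t *\<^sub>R v) $ i $ j * v $ i * v $ j)) (at t)"
proof -
  have "((\<lambda>t. \<Sum>j\<in>UNIV. partial_deriv j f (a + t *\<^sub>R v) * v $ j) has_real_derivative
      (\<Sum>j\<in>UNIV. (grad (partial_deriv j f) (a + t *\<^sub>R v) \<bullet> v) * v $ j)) (at t)"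
    by (intro DERIV_sum DERIV_cmult_right real_polynomial_function_has_derivative_line
        real_polynomial_function_partial_deriv assms)
  moreover have "(\<Sum>j\<in>UNIV. (grad (partial_deriv j f) (a + t *\<^sub>R v) \<bullet> v) * v $ j) =
      (\<Sum>i\<in>UNIV. \<Sum>j\<in>UNIV. hessian f (a + t *\<^sub>R v) $ i $ j * v $ i * v $ j)"
    unfolding inner_vec_def sum_distrib_right
    by (subst sum.swap) (simp add: grad_def hessian_def)
  moreover have "(\<lambda>t. grad f (a + t *\<^sub>R v) \<bullet> v) =
      (\<lambda>t. \<Sum>j\<in>UNIV. partial_deriv j f (a + t *\<^sub>R v) * v $ j)"
    by (simp add: inner_vec_def grad_def)
  ultimately show ?thesis by simp
qed

section \<open>Expansion of polynomials in the segment parameter\<close>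

text \<open>The coefficients of the powers of \<open>t\<close> are themselves polynomials in the
  endpoint \<open>x\<close>. Requiring them to vanish above \<open>N\<close> lets the bound be
  raised freely and makes the Cauchy product formula applicable.\<close>

definition line_expansion ::
    "'a::real_normed_vector \<Rightarrow> ('a \<Rightarrow> real) \<Rightarrow> nat \<Rightarrow> (nat \<Rightarrow> 'a \<Rightarrow> real) \<Rightarrow> bool" where
  "line_expansion a f N q \<longleftrightarrow>
     (\<forall>k. real_polynomial_function (q k)) \<and> (\<forall>k>N. \<forall>x. q k x = 0) \<and>
     (\<forall>t x. f (a + t *\<^sub>R (x - a)) = (\<Sum>k\<le>N. q k x * t ^ k))"

lemma line_expansion_mono:
  assumes "line_expansion a f N q" "N \<le> M"
  shows "line_expansion a f M q"
proof -
  have "(\<Sum>k\<le>N. q k x * t ^ k) = (\<Sum>k\<le>M. q k x * t ^ k)" for t x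
    using assms by (intro sum.mono_neutral_left) (auto simp: line_expansion_def)
  then show ?thesis using assms by (auto simp: line_expansion_def)
qed

text \<open>Structural induction: a linear function becomes affine in \<open>t\<close>, sums add
  coefficients after the bounds are equalized, and products take Cauchy products of
  coefficients.\<close>

lemma line_expansion_exists:
  assumes "real_polynomial_function f"
  shows "\<exists>N q. line_expansion a f N q"
  using assms
proof (induction f rule: real_polynomial_function.induct)
  case (linear f)
  interpret bounded_linear f by fact
  define q where "q = (\<lambda>(k::nat) x. if k = 0 then f a else if k = 1 then f x - f a else 0)"
  have "real_polynomial_function (q k)" for k
  proof -
    have "real_polynomial_function (\<lambda>x. f x - f a)"
      by (rule real_polynomial_function_diff[OF real_polynomial_function.intros(1)[OF bounded_linear_axioms]]) auto
    then show ?thesis by (cases "k = 0"; cases "k = 1") (auto simp: q_def)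
  qed
  then have "line_expansion a f 1 q"
    by (auto simp: line_expansion_def q_def add scaleR diff algebra_simps)
  then show ?case by blast
next
  case (const c)
  have "real_polynomial_function (\<lambda>x::'a. if k = 0 then c else 0)" for k :: nat
    by auto
  then have "line_expansion a (\<lambda>x. c) 0 (\<lambda>k x. if k = 0 then c else 0)"
    by (auto simp: line_expansion_def)
  then show ?case by blast
next
  case (add f g)
  then obtain M N q r where "line_expansion a f M q" "line_expansion a g N r" by blast
  then have "line_expansion a f (max M N) q" "line_expansion a g (max M N) r"
    by (auto intro: line_expansion_mono)
  then have "line_expansion a (\<lambda>x. f x + g x) (max M N) (\<lambda>k x. q k x + r k x)"
    by (auto simp: line_expansion_def sum.distrib distrib_right)
  then show ?case by blast
next
  case (mult f g)
  then obtain M N q r where qr: "line_expansion a f M q" "line_expansion a g N r" by blast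
  define p where "p = (\<lambda>k x. \<Sum>i\<le>k. q i x * r (k - i) x)"
  have "real_polynomial_function (p k)" for k
    unfolding p_def using qr
    by (intro real_polynomial_function_sum real_polynomial_function.intros(4))
      (auto simp: line_expansion_def)
  moreover have "p k x = 0" if "M + N < k" for k x
    unfolding p_def
  proof (rule sum.neutral, safe)
    fix i assume "i \<le> k"
    show "q i x * r (k - i) x = 0"
    proof (cases "M < i")
      case False
      \<comment> \<open>When \<open>i\<close> does not exceed \<open>M\<close>, the second factor
        has index above \<open>N\<close>, so one of the two factors always vanishes.\<close>
      then have "N < k - i" using that by linarith
      then show ?thesis using qr by (auto simp: line_expansion_def)
    qed (use qr in \<open>auto simp: line_expansion_def\<close>)
  qed
  moreover have "f (a + t *\<^sub>R (x - a)) * g (a + t *\<^sub>R (x - a)) = (\<Sum>k\<le>M+N. p k x * t ^ k)" for t x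
    using qr polynomial_product[of M "\<lambda>k. q k x" N "\<lambda>k. r k x" t]
    by (auto simp: line_expansion_def p_def)
  ultimately have "line_expansion a (\<lambda>x. f x * g x) (M + N) p"
    by (simp add: line_expansion_def)
  then show ?case by blast
qed

section \<open>Closure properties of sums of squares\<close>

lemma sum_of_squares_0: "sum_of_squares (\<lambda>x. 0)"
  unfolding sum_of_squares_def by (intro exI[of _ 0]) auto

lemma sum_of_squares_add:
  assumes "sum_of_squares f" "sum_of_squares g"
  shows "sum_of_squares (\<lambda>x. f x + g x)"
proof -
  obtain s :: nat and q where q: "\<forall>l<s. real_polynomial_function (q l)" "\<And>x. f x = (\<Sum>l<s. (q l x)\<^sup>2)"
    using assms(1) unfolding sum_of_squares_def by blast
  obtain s' :: nat and r where r: "\<forall>l<s'. real_polynomial_function (r l)" "\<And>x. g x = (\<Sum>l<s'. (r l x)\<^sup>2)"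
    using assms(2) unfolding sum_of_squares_def by blast
  define u where "u = (\<lambda>l. if l < s then q l else r (l - s))"
  have "(\<Sum>l<s + s'. (u l x)\<^sup>2) = f x + g x" for x
  proof -
    have "(\<Sum>l<s + s'. (u l x)\<^sup>2) = (\<Sum>l<s. (u l x)\<^sup>2) + (\<Sum>l=s..<s + s'. (u l x)\<^sup>2)"
      by (simp add: lessThan_atLeast0 sum.atLeastLessThan_concat)
    also have "(\<Sum>l=s..<s + s'. (u l x)\<^sup>2) = (\<Sum>l<s'. (u (l + s) x)\<^sup>2)"
      using sum.shift_bounds_nat_ivl[of "\<lambda>l. (u l x)\<^sup>2" 0 s s']
      by (simp add: lessThan_atLeast0 add.commute)
    finally show ?thesis by (simp add: u_def q r)
  qed
  moreover have "\<forall>l<s + s'. real_polynomial_function (u l)"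
    using q r by (auto simp: u_def)
  ultimately show ?thesis unfolding sum_of_squares_def by metis
qed

lemma sum_of_squares_sum:
  assumes "finite I" "\<And>i. i \<in> I \<Longrightarrow> sum_of_squares (f i)"
  shows "sum_of_squares (\<lambda>x. \<Sum>i\<in>I. f i x)"
  using assms by (induction I rule: finite_induct) (auto simp: sum_of_squares_0 sum_of_squares_add)

lemma sum_of_squares_power2:
  assumes "real_polynomial_function q"
  shows "sum_of_squares (\<lambda>x. (q x)\<^sup>2)"
  unfolding sum_of_squares_def
  by (intro exI[of _ 1] exI[of _ "\<lambda>_. q"]) (simp add: assms)

lemma sum_of_squares_cmult:
  assumes "0 \<le> c" "sum_of_squares f"
  shows "sum_of_squares (\<lambda>x. c * f x)"
proof -
  obtain s :: nat and q where q: "\<forall>l<s. real_polynomial_function (q l)" "\<And>x. f x = (\<Sum>l<s. (q l x)\<^sup>2)"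
    using assms(2) unfolding sum_of_squares_def by blast
  have "c * f x = (\<Sum>l<s. (sqrt c * q l x)\<^sup>2)" for x
    using assms(1) by (simp add: q sum_distrib_left power_mult_distrib)
  moreover have "\<forall>l<s. real_polynomial_function (\<lambda>x. sqrt c * q l x)"
    using q by auto
  ultimately show ?thesis unfolding sum_of_squares_def 
    by (intro exI[of _ s] exI[of _ "\<lambda>l x. sqrt c * q l x"]) simp
qed

lemma sum_of_squares_nonneg: "sum_of_squares f \<Longrightarrow> 0 \<le> f x"
  unfolding sum_of_squares_def by (metis sum_nonneg zero_le_power2)

text \<open>Along the segment from \<open>a\<close> to \<open>x\<close>, each column of the Hessian
  factor contributes the square of a polynomial in \<open>t\<close> with coefficients
  \<open>c l k x\<close>. The remainder is then the weight form in these coefficients, and its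
  factorization yields squares of polynomials in \<open>x\<close>.\<close>

lemma SOS_convex_remainder:
  fixes f :: "real ^ 'n \<Rightarrow> real"
  assumes "SOS_convex f"
  shows "sum_of_squares (\<lambda>x. f x - f a - grad f a \<bullet> (x - a))"
proof -
  have pf: "real_polynomial_function f" using assms by (simp add: SOS_convex_def)
  obtain s and H :: "'n \<Rightarrow> nat \<Rightarrow> real ^ 'n \<Rightarrow> real" where
    Hp: "\<And>i l. l < s \<Longrightarrow> real_polynomial_function (H i l)" and
    H: "\<And>x i j. hessian f x $ i $ j = (\<Sum>l<s. H i l x * H j l x)"
    using assms unfolding SOS_convex_def SOS_matrix_polynomial_def by blast
  \<comment> \<open>Extending by zero past column \<open>s\<close> gives an expansion for every
    index pair, so \<open>qq\<close> and \<open>NN\<close> can be chosen globally.\<close>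
  define G where "G = (\<lambda>i l. if l < s then H i l else (\<lambda>x. 0))"
  have "\<exists>N q. line_expansion a (G i l) N q" for i l
    by (rule line_expansion_exists) (auto simp: G_def Hp)
  then obtain NN qq where qq: "\<And>i l. line_expansion a (G i l) (NN i l) (qq i l)" by metis
  \<comment> \<open>A common bound for all entries. For \<open>s = 0\<close> the set is empty and
    any value of \<open>N\<close> will do, since \<open>exp\<close> concerns only
    \<open>l < s\<close>.\<close>
  define N where "N = Max ((\<lambda>(i, l). NN i l) ` (UNIV \<times> {..<s}))"
  have exp: "line_expansion a (G i l) N (qq i l)" if "l < s" for i l
    using that by (intro line_expansion_mono[OF qq]) (auto simp: N_def intro!: Max_ge)
  \<comment> \<open>The coefficient of \<open>t ^ k\<close> in the inner product of
    \<open>x - a\<close> with column \<open>l\<close> of \<open>H\<close> at the moving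
    point.\<close>
  define c where "c = (\<lambda>l k x. \<Sum>i\<in>UNIV. (x - a) $ i * qq i l k x)"
  have cp: "real_polynomial_function (c l k)" for l k
  proof -
    have "real_polynomial_function (\<lambda>x. (x - a) $ i)" for i
      using real_polynomial_function_diff[OF
          real_polynomial_function.intros(1)[OF bounded_linear_vec_nth]
          real_polynomial_function.intros(2)]
      by simp
    moreover have "real_polynomial_function (qq i l k)" for i
      using qq[of i l] by (auto simp: line_expansion_def)
    ultimately show ?thesis
      unfolding c_def by (intro real_polynomial_function_sum real_polynomial_function.intros(4)) auto
  qed
  \<comment> \<open>Fixed before \<open>x\<close> enters, so the linear forms in the
    \<open>c l k\<close> are polynomials in \<open>x\<close>.\<close>
  obtain A where A: "\<And>b. (\<Sum>i<Suc N. \<Sum>j<Suc N. taylor_weight i j * b i * b j) =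
      (\<Sum>l<Suc N. (\<Sum>k<Suc N. A l k * b k)\<^sup>2)"
    using taylor_weight_form_eq_sum_squares by blast
  have "f x - f a - grad f a \<bullet> (x - a) = (\<Sum>l<s. \<Sum>m<Suc N. (\<Sum>k<Suc N. A m k * c l k x)\<^sup>2)" for x
  proof -
    have hess: "(\<Sum>i\<in>UNIV. \<Sum>j\<in>UNIV. hessian f (a + t *\<^sub>R (x - a)) $ i $ j * (x - a) $ i * (x - a) $ j) =
        (\<Sum>l<s. (\<Sum>k<Suc N. c l k x * t ^ k)\<^sup>2)" for t
    proof -
      let ?z = "a + t *\<^sub>R (x - a)"
      have "(\<Sum>i\<in>UNIV. \<Sum>j\<in>UNIV. hessian f ?z $ i $ j * (x - a) $ i * (x - a) $ j) =
          (\<Sum>i\<in>UNIV. \<Sum>j\<in>UNIV. \<Sum>l<s. ((x - a) $ i * H i l ?z) * ((x - a) $ j * H j l ?z))"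
        by (simp add: H sum_distrib_left mult_ac)
      also have "\<dots> = (\<Sum>i\<in>UNIV. \<Sum>l<s. \<Sum>j\<in>UNIV. ((x - a) $ i * H i l ?z) * ((x - a) $ j * H j l ?z))"
        by (intro sum.cong sum.swap refl)
      also have "\<dots> = (\<Sum>l<s. (\<Sum>i\<in>UNIV. (x - a) $ i * H i l ?z)\<^sup>2)"
        unfolding power2_eq_square sum_product by (rule sum.swap)
      also have "\<dots> = (\<Sum>l<s. (\<Sum>k<Suc N. c l k x * t ^ k)\<^sup>2)"
      proof (intro sum.cong refl)
        fix l assume "l \<in> {..<s}"
        then have l: "l < s" by simp
        have "H i l ?z = (\<Sum>k<Suc N. qq i l k x * t ^ k)" for i
          using exp[OF l, of i] l by (simp add: line_expansion_def G_def lessThan_Suc_atMost)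
        then have "(\<Sum>i\<in>UNIV. (x - a) $ i * H i l ?z) =
            (\<Sum>i\<in>UNIV. \<Sum>k<Suc N. (x - a) $ i * qq i l k x * t ^ k)"
          by (simp only: sum_distrib_left mult.assoc)
        also have "\<dots> = (\<Sum>k<Suc N. c l k x * t ^ k)"
          unfolding c_def sum_distrib_right by (rule sum.swap)
        finally show "(\<Sum>i\<in>UNIV. (x - a) $ i * H i l ?z)\<^sup>2 = (\<Sum>k<Suc N. c l k x * t ^ k)\<^sup>2"
          by simp
      qed
      finally show ?thesis .
    qed
    have "f (a + 1 *\<^sub>R (x - a)) - f (a + 0 *\<^sub>R (x - a)) - grad f (a + 0 *\<^sub>R (x - a)) \<bullet> (x - a) =
        (\<Sum>l<s. \<Sum>i<Suc N. \<Sum>j<Suc N. taylor_weight i j * c l i x * c l j x)"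
    proof (rule taylor_remainder_of_squares)
      show "((\<lambda>t. grad f (a + t *\<^sub>R (x - a)) \<bullet> (x - a)) has_real_derivative
          (\<Sum>l<s. (\<Sum>i<Suc N. c l i x * t ^ i)\<^sup>2)) (at t)" for t
        using real_polynomial_function_has_second_derivative_line[OF pf, of a "x - a" t]
        unfolding hess .
    qed (rule real_polynomial_function_has_derivative_line[OF pf])
    then show ?thesis by (simp only: A) simp
  qed
  moreover have "sum_of_squares (\<lambda>x. \<Sum>l<s. \<Sum>m<Suc N. (\<Sum>k<Suc N. A m k * c l k x)\<^sup>2)"
    by (intro sum_of_squares_sum sum_of_squares_power2 real_polynomial_function_sum
        real_polynomial_function.intros(2,4) cp) auto
  ultimately show ?thesis by presburger
qed

section \<open>Total degree\<close>

text \<open>The predicate minimized in \<open>total_degree\<close>. Upper bounds obey simple closure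
  rules, whereas the exact degree may drop through cancellation.\<close>

definition degree_at_most :: "nat \<Rightarrow> (real ^ 'n \<Rightarrow> real) \<Rightarrow> bool" where
  "degree_at_most k f \<longleftrightarrow> (\<exists>c. \<forall>x. f x = (\<Sum>\<alpha> | sum \<alpha> UNIV \<le> k. c \<alpha> * monom_fun \<alpha> x))"

lemma finite_multi_indices: "finite {\<alpha> :: 'n::finite \<Rightarrow> nat. sum \<alpha> UNIV \<le> k}"
proof (rule finite_subset)
  show "{\<alpha> :: 'n \<Rightarrow> nat. sum \<alpha> UNIV \<le> k} \<subseteq> PiE UNIV (\<lambda>_. {..k})"
  proof (clarsimp simp: PiE_iff)
    fix \<alpha> :: "'n \<Rightarrow> nat" and i
    assume "sum \<alpha> UNIV \<le> k"
    moreover have "\<alpha> i \<le> sum \<alpha> UNIV" by (rule member_le_sum) auto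
    ultimately show "\<alpha> i \<le> k" by (rule order_trans[rotated])
  qed
qed (simp add: finite_PiE)

lemma degree_at_most_mono:
  fixes f :: "real ^ 'n \<Rightarrow> real"
  assumes "degree_at_most j f" "j \<le> k"
  shows "degree_at_most k f"
proof -
  obtain c where c: "\<And>x. f x = (\<Sum>\<alpha> | sum \<alpha> UNIV \<le> j. c \<alpha> * monom_fun \<alpha> x)"
    using assms(1) unfolding degree_at_most_def by blast
  have "f x = (\<Sum>\<alpha> | sum \<alpha> UNIV \<le> k. (if sum \<alpha> UNIV \<le> j then c \<alpha> else 0) * monom_fun \<alpha> x)" for x
    unfolding c using assms(2) by (intro sum.mono_neutral_cong_left finite_multi_indices) auto
  then show ?thesis
    unfolding degree_at_most_def
    by (intro exI[of _ "\<lambda>\<alpha>. if sum \<alpha> UNIV \<le> j then c \<alpha> else 0"]) blast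
qed

lemma degree_at_most_monom:
  fixes \<alpha> :: "'n::finite \<Rightarrow> nat"
  assumes "sum \<alpha> UNIV \<le> k"
  shows "degree_at_most k (monom_fun \<alpha>)"
proof -
  have "monom_fun \<alpha> x = (\<Sum>\<beta> | sum \<beta> UNIV \<le> k. (if \<beta> = \<alpha> then 1 else 0) * monom_fun \<beta> x)" for x
  proof -
    have "(\<Sum>\<beta> | sum \<beta> UNIV \<le> k. (if \<beta> = \<alpha> then 1 else 0) * monom_fun \<beta> x) =
        (\<Sum>\<beta> | sum \<beta> UNIV \<le> k. if \<beta> = \<alpha> then monom_fun \<beta> x else 0)"
      by (intro sum.cong) auto
    also have "\<dots> = monom_fun \<alpha> x"
      using assms by (subst sum.delta[OF finite_multi_indices]) simp
    finally show ?thesis ..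
  qed
  then show ?thesis
    unfolding degree_at_most_def by (intro exI[of _ "\<lambda>\<beta>. if \<beta> = \<alpha> then 1 else 0"]) blast
qed

lemma degree_at_most_add:
  assumes "degree_at_most k f" "degree_at_most k g"
  shows "degree_at_most k (\<lambda>x. f x + g x)"
proof -
  obtain c where "\<And>x. f x = (\<Sum>\<alpha> | sum \<alpha> UNIV \<le> k. c \<alpha> * monom_fun \<alpha> x)"
    using assms(1) unfolding degree_at_most_def by blast
  moreover obtain b where "\<And>x. g x = (\<Sum>\<alpha> | sum \<alpha> UNIV \<le> k. b \<alpha> * monom_fun \<alpha> x)"
    using assms(2) unfolding degree_at_most_def by blast
  ultimately show ?thesis
    unfolding degree_at_most_def
    by (intro exI[of _ "\<lambda>\<alpha>. c \<alpha> + b \<alpha>"]) (simp add: distrib_right sum.distrib)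
qed

lemma degree_at_most_cmult:
  assumes "degree_at_most k f"
  shows "degree_at_most k (\<lambda>x. a * f x)"
proof -
  obtain c where "\<And>x. f x = (\<Sum>\<alpha> | sum \<alpha> UNIV \<le> k. c \<alpha> * monom_fun \<alpha> x)"
    using assms(1) unfolding degree_at_most_def by blast
  then show ?thesis
    unfolding degree_at_most_def
    by (intro exI[of _ "\<lambda>\<alpha>. a * c \<alpha>"]) (simp add: sum_distrib_left mult.assoc)
qed

lemma degree_at_most_const: "degree_at_most k (\<lambda>x. a)"
  using degree_at_most_cmult[OF degree_at_most_monom[of "\<lambda>_. 0" k], of a]
  by (simp add: monom_fun_def)

lemma degree_at_most_sum:
  assumes "finite I" "\<And>i. i \<in> I \<Longrightarrow> degree_at_most k (f i)"
  shows "degree_at_most k (\<lambda>x. \<Sum>i\<in>I. f i x)"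
  using assms
  by (induction I rule: finite_induct) (auto simp: degree_at_most_const degree_at_most_add)

text \<open>Exponents of monomials add. Distinct pairs may give the same monomial, so the product is
  treated as a finite sum of functions of bounded degree instead of collecting coefficients.\<close>

lemma degree_at_most_mult:
  fixes f g :: "real ^ 'n \<Rightarrow> real"
  assumes "degree_at_most j f" "degree_at_most k g"
  shows "degree_at_most (j + k) (\<lambda>x. f x * g x)"
proof -
  obtain c where c: "\<And>x. f x = (\<Sum>\<alpha> | sum \<alpha> UNIV \<le> j. c \<alpha> * monom_fun \<alpha> x)"
    using assms(1) unfolding degree_at_most_def by blast
  obtain b where b: "\<And>x. g x = (\<Sum>\<alpha> | sum \<alpha> UNIV \<le> k. b \<alpha> * monom_fun \<alpha> x)"
    using assms(2) unfolding degree_at_most_def by blast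
  have monom: "monom_fun \<alpha> x * monom_fun \<beta> x = monom_fun (\<lambda>i. \<alpha> i + \<beta> i) x"
    for \<alpha> \<beta> and x :: "real ^ 'n"
    by (simp add: monom_fun_def power_add prod.distrib)
  have "f x * g x = (\<Sum>\<alpha> | sum \<alpha> UNIV \<le> j. \<Sum>\<beta> | sum \<beta> UNIV \<le> k.
      (c \<alpha> * b \<beta>) * monom_fun (\<lambda>i. \<alpha> i + \<beta> i) x)" for x
    unfolding c b sum_product monom[symmetric] by (simp add: mult_ac)
  moreover have "degree_at_most (j + k) (\<lambda>x. \<Sum>\<alpha> | sum \<alpha> UNIV \<le> j. \<Sum>\<beta> | sum \<beta> UNIV \<le> k.
      (c \<alpha> * b \<beta>) * monom_fun (\<lambda>i. \<alpha> i + \<beta> i) x)"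
    by (intro degree_at_most_sum finite_multi_indices degree_at_most_cmult degree_at_most_monom)
      (simp add: sum.distrib add_mono)
  ultimately show ?thesis by presburger
qed

text \<open>Ensures that the minimum defining \<open>total_degree\<close> is attained for polynomial
  functions.\<close>

lemma degree_at_most_exists:
  fixes f :: "real ^ 'n \<Rightarrow> real"
  assumes "real_polynomial_function f"
  shows "\<exists>k. degree_at_most k f"
  using assms
proof (induction f rule: real_polynomial_function.induct)
  case (linear f)
  interpret bounded_linear f by fact
  have expand: "f x = (\<Sum>i\<in>UNIV. f (axis i 1) * monom_fun (\<lambda>j. if j = i then 1 else 0) x)" for x
  proof -
    have "f x = f (\<Sum>i\<in>UNIV. (x $ i) *\<^sub>R axis i 1)"
      using basis_expansion[of x] by (simp add: scalar_mult_eq_scaleR)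
    also have "\<dots> = (\<Sum>i\<in>UNIV. f (axis i 1) * x $ i)"
      by (simp add: sum scaleR mult.commute)
    also have "\<dots> = (\<Sum>i\<in>UNIV. f (axis i 1) * monom_fun (\<lambda>j. if j = i then 1 else 0) x)"
    proof (intro sum.cong refl)
      fix i
      have "monom_fun (\<lambda>j. if j = i then 1 else 0) x = (\<Prod>j\<in>UNIV. if j = i then x $ j else 1)"
        unfolding monom_fun_def by (intro prod.cong) auto
      then show "f (axis i 1) * x $ i = f (axis i 1) * monom_fun (\<lambda>j. if j = i then 1 else 0) x"
        by simp
    qed
    finally show ?thesis .
  qed
  have "degree_at_most 1 (\<lambda>x. \<Sum>i\<in>UNIV. f (axis i 1) * monom_fun (\<lambda>j. if j = i then 1 else 0) x)"
    by (intro degree_at_most_sum degree_at_most_cmult degree_at_most_monom) auto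
  then show ?case unfolding expand[symmetric] by blast
next
  case (const c)
  show ?case by (intro exI degree_at_most_const)
next
  case (add f g)
  then obtain j k where f: "degree_at_most j f" and g: "degree_at_most k g" by blast
  have "degree_at_most (max j k) f" "degree_at_most (max j k) g"
    by (rule degree_at_most_mono[OF f] degree_at_most_mono[OF g], simp)+
  then show ?case by (intro exI[of _ "max j k"] degree_at_most_add)
next
  case (mult f g)
  then obtain j k where "degree_at_most j f" "degree_at_most k g" by blast
  then show ?case by (intro exI[of _ "j + k"] degree_at_most_mult)
qed

lemma total_degree_eq_Least: "total_degree f = (LEAST k. degree_at_most k f)"
  unfolding total_degree_def degree_at_most_def ..

lemma total_degree_le_iff:
  assumes "real_polynomial_function f"
  shows "total_degree f \<le> k \<longleftrightarrow> degree_at_most k f"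
proof
  assume "total_degree f \<le> k"
  moreover have "degree_at_most (total_degree f) f"
    unfolding total_degree_eq_Least using degree_at_most_exists[OF assms] by (rule LeastI_ex)
  ultimately show "degree_at_most k f" by (rule degree_at_most_mono[rotated])
next
  assume "degree_at_most k f"
  then show "total_degree f \<le> k" unfolding total_degree_eq_Least by (rule Least_le)
qed

section \<open>Convexity, multipliers and duality\<close>

lemma SOS_convex_above_tangent:
  "SOS_convex f \<Longrightarrow> f a + grad f a \<bullet> (x - a) \<le> f x"
  using sum_of_squares_nonneg[OF SOS_convex_remainder, of f x a] by simp

text \<open>Add the tangent inequalities at the convex combination \<open>z\<close>, weighted as in
  \<open>z\<close>; the weighted displacements sum to zero, so the gradient terms cancel.\<close>

lemma SOS_convex_imp_convex_on:
  fixes f :: "real ^ 'n \<Rightarrow> real"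
  assumes "SOS_convex f"
  shows "convex_on UNIV f"
proof (rule convex_onI)
  fix t :: real and x y :: "real ^ 'n"
  assume t: "0 < t" "t < 1"
  define z where "z = (1 - t) *\<^sub>R x + t *\<^sub>R y"
  have "(1 - t) * (f z + grad f z \<bullet> (x - z)) + t * (f z + grad f z \<bullet> (y - z)) \<le>
      (1 - t) * f x + t * f y"
    using t by (intro add_mono mult_left_mono SOS_convex_above_tangent assms) auto
  also have "(1 - t) * (f z + grad f z \<bullet> (x - z)) + t * (f z + grad f z \<bullet> (y - z)) =
      f z + grad f z \<bullet> ((1 - t) *\<^sub>R (x - z) + t *\<^sub>R (y - z))"
    by (simp add: inner_add_right inner_diff_right algebra_simps)
  also have "(1 - t) *\<^sub>R (x - z) + t *\<^sub>R (y - z) = 0"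
    by (simp add: z_def algebra_simps)
  finally show "f ((1 - t) *\<^sub>R x + t *\<^sub>R y) \<le> (1 - t) * f x + t * f y"
    by (simp add: z_def)
qed simp

lemma convex_feasible_set:
  assumes "\<And>i. convex_on UNIV (g i)"
  shows "convex (feasible_set g)"
proof (rule convexI)
  fix x y and s t :: real
  assume xy: "x \<in> feasible_set g" "y \<in> feasible_set g" and st: "0 \<le> s" "0 \<le> t" "s + t = 1"
  have "g i (s *\<^sub>R x + t *\<^sub>R y) \<le> 0" for i
  proof -
    have "g i (s *\<^sub>R x + t *\<^sub>R y) \<le> s * g i x + t * g i y"
      using assms[of i] st unfolding convex_on_def by simp
    also have "\<dots> \<le> 0"
      using xy st by (intro add_nonpos_nonpos) (auto simp: feasible_set_def mult_nonneg_nonpos)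
    finally show ?thesis .
  qed
  then show "s *\<^sub>R x + t *\<^sub>R y \<in> feasible_set g" by (simp add: feasible_set_def)
qed

text \<open>
  Separate the origin from the convex set of all vectors that strictly dominate
  \<open>(p\<^sub>j y - v)\<^sub>j\<close> for some \<open>y\<close> of the domain; this set is closed upwards, so the normal is
  nonnegative.
\<close>
lemma minimax_multipliers:
  fixes p :: "'r::finite \<Rightarrow> 'a::real_vector \<Rightarrow> real"
  assumes "convex F" "F \<noteq> {}" "\<And>j. convex_on F (p j)"
    and le: "\<And>y. y \<in> F \<Longrightarrow> \<exists>j. v \<le> p j y"
  shows "\<exists>\<delta>\<in>unit_simplex. \<forall>y\<in>F. v \<le> (\<Sum>j\<in>UNIV. \<delta> $ j * p j y)"
proof -
  define K where "K = {u :: real ^ 'r. \<exists>y\<in>F. \<forall>j. p j y - v < u $ j}"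
  have "convex K"
    unfolding convex_def
  proof (intro ballI allI impI)
    fix u1 u2 s t
    assume "u1 \<in> K" "u2 \<in> K" and st: "(0::real) \<le> s" "0 \<le> t" "s + t = 1"
    then obtain y1 y2 where y: "y1 \<in> F" "y2 \<in> F"
      "\<And>j. p j y1 - v < u1 $ j" "\<And>j. p j y2 - v < u2 $ j" unfolding K_def by blast
    have "p j (s *\<^sub>R y1 + t *\<^sub>R y2) - v < (s *\<^sub>R u1 + t *\<^sub>R u2) $ j" for j
    proof -
      have "p j (s *\<^sub>R y1 + t *\<^sub>R y2) - v \<le> s * p j y1 + t * p j y2 - (s + t) * v"
        using assms(3)[of j] y st unfolding convex_on_def by simp
      also have "\<dots> = s * (p j y1 - v) + t * (p j y2 - v)" by (simp add: algebra_simps)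
      also have "\<dots> < s * u1 $ j + t * u2 $ j"
      \<comment> \<open>Strictness must come from a positive weight: from \<open>s\<close> if it is
        nonzero, otherwise from \<open>t = 1\<close>.\<close>
      proof (cases "s = 0")
        case False
        then have "s * (p j y1 - v) < s * u1 $ j" using st y(3)[of j] by simp
        moreover have "t * (p j y2 - v) \<le> t * u2 $ j"
          using st y(4)[of j] by (intro mult_left_mono) auto
        ultimately show ?thesis by simp
      qed (use st y(4)[of j] in simp)
      finally show ?thesis by simp
    qed
    moreover have "s *\<^sub>R y1 + t *\<^sub>R y2 \<in> F" using assms(1) y st by (simp add: convexD)
    ultimately show "s *\<^sub>R u1 + t *\<^sub>R u2 \<in> K" unfolding K_def by blast
  qed
  moreover have "0 \<notin> K"
  proof
    assume "0 \<in> K"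
    then obtain y where "y \<in> F" "\<And>j. p j y < v" by (auto simp: K_def)
    then show False using le by (meson not_less)
  qed
  ultimately obtain a where a: "a \<noteq> 0" "\<And>u. u \<in> K \<Longrightarrow> 0 \<le> a \<bullet> u"
    using separating_hyperplane_set_0 by blast
  \<comment> \<open>The vector of shifted values raised by a slack \<open>e\<close>; positive slack
    puts it into \<open>K\<close>, where domination is strict.\<close>
  define w where "w = (\<lambda>y (e::real). \<chi> j. p j y - v + e)"
  have wK: "w y e \<in> K" if "y \<in> F" "0 < e" for y e
    using that by (auto simp: K_def w_def intro!: bexI[of _ y])
  have a_nonneg: "0 \<le> a $ j" for j
  proof (rule ccontr)
    assume neg: "\<not> 0 \<le> a $ j"
    obtain y where y: "y \<in> F" using assms(2) by blast
    \<comment> \<open>If \<open>a $ j\<close> were negative, moving up by \<open>T\<close> along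
      axis \<open>j\<close> would stay in \<open>K\<close> and lower the inner product with
      \<open>a\<close> to exactly -1.\<close>
    define T where "T = (a \<bullet> w y 1 + 1) / - a $ j"
    have "0 \<le> a \<bullet> w y 1" using a wK y by simp
    then have "0 \<le> T" using neg by (simp add: T_def divide_nonneg_neg)
    then have "w y 1 + T *\<^sub>R axis j 1 \<in> K"
      using y by (auto simp: K_def w_def axis_def intro!: bexI[of _ y])
    then have "0 \<le> a \<bullet> w y 1 + T * a $ j"
      using a(2) by (fastforce simp: inner_add_right inner_axis)
    also have "\<dots> = -1" using neg by (simp add: T_def)
    finally show False by simp
  qed
  define S where "S = (\<Sum>j\<in>UNIV. a $ j)"
  have S: "0 < S"
  proof -
    have "S \<noteq> 0"
      using a(1) a_nonneg sum_nonneg_eq_0_iff[of UNIV "\<lambda>j. a $ j"] by (auto simp: S_def vec_eq_iff)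
    moreover have "0 \<le> S" unfolding S_def using a_nonneg by (simp add: sum_nonneg)
    ultimately show ?thesis by simp
  qed
  have inner_w: "a \<bullet> w y e = (\<Sum>j\<in>UNIV. a $ j * p j y) - S * v + S * e" for y e
    by (simp add: inner_vec_def w_def S_def sum.distrib sum_subtractf sum_distrib_left algebra_simps)
  have "S * v \<le> (\<Sum>j\<in>UNIV. a $ j * p j y)" if "y \<in> F" for y
  proof (rule field_le_epsilon)
    fix e :: real assume "0 < e"
    \<comment> \<open>Slack \<open>e / S\<close> in every coordinate changes the inner product by
      exactly \<open>e\<close>.\<close>
    then have "0 \<le> a \<bullet> w y (e / S)" using S that by (intro a wK) auto
    then show "S * v \<le> (\<Sum>j\<in>UNIV. a $ j * p j y) + e" unfolding inner_w using S by simp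
  qed
  then have "v \<le> (\<Sum>j\<in>UNIV. ((1 / S) *\<^sub>R a) $ j * p j y)" if "y \<in> F" for y
    using that S by (simp add: sum_divide_distrib[symmetric] pos_le_divide_eq mult.commute)
  moreover have "(1 / S) *\<^sub>R a \<in> unit_simplex"
    using S a_nonneg
    by (simp add: unit_simplex_def nonneg_orthant_def sum_divide_distrib[symmetric] S_def[symmetric])
  ultimately show ?thesis by blast
qed

text \<open>A negative derivative in the direction of some \<open>y\<close> in \<open>F\<close>
  would let a short step towards \<open>y\<close>, which stays in \<open>F\<close> by convexity,
  decrease \<open>f\<close>.\<close>

lemma minus_grad_in_normal_cone:
  assumes "convex F" "x \<in> F" "real_polynomial_function f" "\<And>y. y \<in> F \<Longrightarrow> f x \<le> f y"
  shows "- grad f x \<in> normal_cone F x"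
  unfolding normal_cone_def
proof (intro CollectI ballI)
  fix y assume y: "y \<in> F"
  have "0 \<le> grad f x \<bullet> (y - x)"
  proof (rule ccontr)
    assume "\<not> 0 \<le> grad f x \<bullet> (y - x)"
    then obtain e where e: "0 < e" "\<And>h. 0 < h \<Longrightarrow> h < e \<Longrightarrow> f (x + h *\<^sub>R (y - x)) < f x"
      using DERIV_neg_dec_right[OF real_polynomial_function_has_derivative_line[OF assms(3)], of x 0 "y - x"]
      by auto
    \<comment> \<open>Halving keeps the step strictly inside the range of decrease; the cap 1 keeps
      it on the segment.\<close>
    define h where "h = min (e / 2) 1"
    have h: "0 < h" "h < e" "h \<le> 1" using e by (auto simp: h_def)
    have "x + h *\<^sub>R (y - x) = (1 - h) *\<^sub>R x + h *\<^sub>R y" by (simp add: algebra_simps)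
    then have "x + h *\<^sub>R (y - x) \<in> F" using assms(1,2) y h by (simp add: convexD)
    then show False using assms(4) e(2)[OF h(1,2)] by fastforce
  qed
  then show "- grad f x \<bullet> (y - x) \<le> 0" by simp
qed

lemma grad_sum:
  fixes f :: "'k \<Rightarrow> real ^ 'n \<Rightarrow> real"
  assumes "\<And>i. i \<in> I \<Longrightarrow> real_polynomial_function (f i)"
  shows "grad (\<lambda>x. \<Sum>i\<in>I. c i * f i x) x = (\<Sum>i\<in>I. c i *\<^sub>R grad (f i) x)"
proof -
  have "((\<lambda>x. \<Sum>i\<in>I. c i * f i x) has_derivative (\<lambda>v. \<Sum>i\<in>I. c i * (grad (f i) x \<bullet> v))) (at x)"
    using assms
    by (intro has_derivative_sum has_derivative_mult_right real_polynomial_function_has_derivative_grad)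
  from partial_deriv_eqI[OF this] show ?thesis
    by (simp add: vec_eq_iff grad_def inner_axis)
qed

section \<open>Strong duality with attainment\<close>

theorem theorem3p5:
  fixes p :: "'r::finite \<Rightarrow> real ^ 'n \<Rightarrow> real"
    and g :: "'m::finite \<Rightarrow> real ^ 'n \<Rightarrow> real"
    and d :: nat
    and xstar :: "real ^ 'n"
  assumes "\<And>j. SOS_convex (p j)"
    and "\<And>i. SOS_convex (g i)"
    and "feasible_set g \<noteq> {}"
    and "d = (LEAST k. even k \<and>
               k \<ge> max (Max (range (\<lambda>j. total_degree (p j)))) (Max (range (\<lambda>i. total_degree (g i)))))"
    and "is_arg_min (primal_objective p) (\<lambda>x. x \<in> feasible_set g) xstar"
    and "normal_cone_condition g xstar"
  shows "primal_value p g = dual_value d p g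
    \<and> (\<exists>x\<in>feasible_set g. ereal (primal_objective p x) = primal_value p g)
    \<and> (\<exists>(\<delta>, \<nu>, \<mu>)\<in>dual_feasible d p g. ereal \<mu> = dual_value d p g)"
proof -
  let ?F = "feasible_set g"
  define v where "v = primal_objective p xstar"
  have pp: "real_polynomial_function (p j)" and gp: "real_polynomial_function (g i)" for i j
    using assms(1,2) by (auto simp: SOS_convex_def)
  have F: "convex ?F"
    using assms(2) by (intro convex_feasible_set SOS_convex_imp_convex_on)
  have xF: "xstar \<in> ?F" and opt: "\<And>y. y \<in> ?F \<Longrightarrow> v \<le> primal_objective p y"
    using assms(5) by (auto simp: is_arg_min_linorder v_def)
  have ple: "p j x \<le> primal_objective p x" for j x
    by (simp add: primal_objective_def)

  \<comment> \<open>A maximum over a finite index type is attained, which turns optimality of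
    \<open>v\<close> into the hypothesis of the multiplier lemma.\<close>
  have "\<exists>j. v \<le> p j y" if "y \<in> ?F" for y
  proof -
    have "primal_objective p y \<in> range (\<lambda>j. p j y)"
      unfolding primal_objective_def by (intro Max_in) auto
    then show ?thesis using opt[OF that] by force
  qed
  then obtain \<delta> where \<delta>: "\<delta> \<in> unit_simplex" "\<And>y. y \<in> ?F \<Longrightarrow> v \<le> (\<Sum>j\<in>UNIV. \<delta> $ j * p j y)"
    using minimax_multipliers[of ?F p v] F assms(1,3) SOS_convex_imp_convex_on
    by (metis convex_on_subset top_greatest)
  have \<delta>_nonneg: "0 \<le> \<delta> $ j" and \<delta>_sum: "(\<Sum>j\<in>UNIV. \<delta> $ j) = 1" for j
    using \<delta>(1) by (auto simp: unit_simplex_def nonneg_orthant_def)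
  have avg_le: "(\<Sum>j\<in>UNIV. \<eta> $ j * p j x) \<le> primal_objective p x" if "\<eta> \<in> unit_simplex" for \<eta> x
  proof -
    have "(\<Sum>j\<in>UNIV. \<eta> $ j * p j x) \<le> (\<Sum>j\<in>UNIV. \<eta> $ j * primal_objective p x)"
      using that by (intro sum_mono mult_left_mono ple) (auto simp: unit_simplex_def nonneg_orthant_def)
    also have "\<dots> = primal_objective p x"
      using that by (simp add: unit_simplex_def sum_distrib_right[symmetric])
    finally show ?thesis .
  qed
  define \<phi> where "\<phi> = (\<lambda>x. \<Sum>j\<in>UNIV. \<delta> $ j * p j x)"
  \<comment> \<open>The average at \<open>xstar\<close> is at most the maximum \<open>v\<close>, and
    at least \<open>v\<close> by the choice of \<delta>.\<close>
  have \<phi>v: "\<phi> xstar = v"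
    using avg_le[OF \<delta>(1), of xstar] \<delta>(2)[OF xF] by (simp add: \<phi>_def v_def)
  have "- grad \<phi> xstar \<in> normal_cone ?F xstar"
  proof (rule minus_grad_in_normal_cone[OF F xF])
    show "real_polynomial_function \<phi>" unfolding \<phi>_def
      by (intro real_polynomial_function_sum real_polynomial_function.intros(2,4) pp) auto
    show "\<phi> xstar \<le> \<phi> y" if "y \<in> ?F" for y
      using \<delta>(2)[OF that] \<phi>v by (simp add: \<phi>_def)
  qed
  \<comment> \<open>The normal cone condition supplies multipliers together with complementary
    slackness.\<close>
  then obtain \<nu> where \<nu>: "\<nu> \<in> nonneg_orthant" "(\<Sum>i\<in>UNIV. \<nu> $ i * g i xstar) = 0"
    "- grad \<phi> xstar = (\<Sum>i\<in>UNIV. \<nu> $ i *\<^sub>R grad (g i) xstar)"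
    using assms(6) unfolding normal_cone_condition_def by blast
  have grad0: "(\<Sum>j\<in>UNIV. \<delta> $ j *\<^sub>R grad (p j) xstar) + (\<Sum>i\<in>UNIV. \<nu> $ i *\<^sub>R grad (g i) xstar) = 0"
    using \<nu>(3) by (simp add: \<phi>_def grad_sum pp neg_eq_iff_add_eq_0)

  define L where "L = (\<lambda>x. (\<Sum>j\<in>UNIV. \<delta> $ j * p j x) + (\<Sum>i\<in>UNIV. \<nu> $ i * g i x) - v)"
  have Lp: "real_polynomial_function L" unfolding L_def
    by (intro real_polynomial_function_diff real_polynomial_function_sum
        real_polynomial_function.intros(2-4) pp gp) auto
  have "L x = (\<Sum>j\<in>UNIV. \<delta> $ j * (p j x - p j xstar - grad (p j) xstar \<bullet> (x - xstar))) +
      (\<Sum>i\<in>UNIV. \<nu> $ i * (g i x - g i xstar - grad (g i) xstar \<bullet> (x - xstar)))" (is "_ = ?R x") for x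
  proof -
    have "?R x = (\<Sum>j\<in>UNIV. \<delta> $ j * p j x) - \<phi> xstar + ((\<Sum>i\<in>UNIV. \<nu> $ i * g i x) - 0) -
        ((\<Sum>j\<in>UNIV. \<delta> $ j *\<^sub>R grad (p j) xstar) + (\<Sum>i\<in>UNIV. \<nu> $ i *\<^sub>R grad (g i) xstar)) \<bullet> (x - xstar)"
      \<comment> \<open>The explicit \<open>- 0\<close> in the claim is rewritten into the
        complementarity sum, which supplies the constant terms of the \<open>g i\<close>.\<close>
      unfolding \<nu>(2)[symmetric]
      by (simp add: \<phi>_def inner_add_left inner_sum_left right_diff_distrib sum_subtractf)
    then show ?thesis unfolding grad0 by (simp add: \<phi>v L_def)
  qed
  moreover have "sum_of_squares ?R"
    using \<delta>_nonneg \<nu>(1) assms(1,2)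
    by (intro sum_of_squares_add sum_of_squares_sum sum_of_squares_cmult SOS_convex_remainder)
      (auto simp: nonneg_orthant_def)
  ultimately have Lsos: "sum_of_squares L" by presburger
  have "d \<ge> max (Max (range (\<lambda>j. total_degree (p j)))) (Max (range (\<lambda>i. total_degree (g i))))"
    (is "d \<ge> ?M")
  proof -
    \<comment> \<open>Twice the maximal degree is an even upper bound, so the least one
      exists.\<close>
    have "even (2 * k) \<and> k \<le> 2 * k" for k :: nat by simp
    from LeastI[where P = "\<lambda>k. even k \<and> ?M \<le> k", OF this] show ?thesis
      unfolding assms(4) by blast
  qed
  then have deg: "total_degree (p j) \<le> d" "total_degree (g i) \<le> d" for i j
    by auto
  have "degree_at_most d (\<lambda>x. (\<Sum>j\<in>UNIV. \<delta> $ j * p j x) + (\<Sum>i\<in>UNIV. \<nu> $ i * g i x) + - v)"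
    using deg by (intro degree_at_most_add degree_at_most_sum degree_at_most_cmult degree_at_most_const)
      (auto simp: total_degree_le_iff pp gp)
  then have "L \<in> SOS_le d"
    using Lsos Lp by (simp add: SOS_le_def total_degree_le_iff L_def)
  then have feas: "(\<delta>, \<nu>, v) \<in> dual_feasible d p g"
    using \<delta>(1) \<nu>(1) by (simp add: dual_feasible_def L_def)

  \<comment> \<open>Weak duality: evaluate the nonnegative certificate at \<open>xstar\<close>,
    where the constraint terms are at most 0 and the average of the \<open>p j\<close> is at most
    \<open>v\<close>.\<close>
  have weak: "\<mu> \<le> v" if "(\<eta>, \<kappa>, \<mu>) \<in> dual_feasible d p g" for \<eta> \<kappa> \<mu>
  proof -
    have \<eta>: "\<eta> \<in> unit_simplex" and \<kappa>: "\<kappa> \<in> nonneg_orthant"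
      and sos: "sum_of_squares (\<lambda>x. (\<Sum>j\<in>UNIV. \<eta> $ j * p j x) + (\<Sum>i\<in>UNIV. \<kappa> $ i * g i x) - \<mu>)"
      using that by (auto simp: dual_feasible_def SOS_le_def)
    have "(\<Sum>i\<in>UNIV. \<kappa> $ i * g i xstar) \<le> 0"
      using \<kappa> xF by (intro sum_nonpos) (auto simp: nonneg_orthant_def feasible_set_def mult_nonneg_nonpos)
    then show ?thesis
      using sum_of_squares_nonneg[OF sos, of xstar] avg_le[OF \<eta>, of xstar] by (simp add: v_def)
  qed
  have primal: "primal_value p g = ereal v"
    unfolding primal_value_def
  proof (rule antisym)
    show "(INF x\<in>?F. ereal (primal_objective p x)) \<le> ereal v"
      unfolding v_def using xF by (rule INF_lower)
    show "ereal v \<le> (INF x\<in>?F. ereal (primal_objective p x))"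
      using opt by (intro INF_greatest) simp
  qed
  have dual: "dual_value d p g = ereal v"
    unfolding dual_value_def
  proof (rule antisym)
    show "(SUP (\<delta>, \<nu>, \<mu>)\<in>dual_feasible d p g. ereal \<mu>) \<le> ereal v"
      using weak by (intro SUP_least) auto
    show "ereal v \<le> (SUP (\<delta>, \<nu>, \<mu>)\<in>dual_feasible d p g. ereal \<mu>)"
      using feas by (intro SUP_upper2[OF feas]) simp
  qed
  show ?thesis
    unfolding primal dual using xF feas v_def by auto
qed

end
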